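(* Let $b$ be a graph over $(X,m)$ and let $d$ be an intrinsic pseudo metric on $X$ with finite distance balls and finite jump size $s<\infty$. Let $0<T\le\infty$ and let $u:(0,T)\times X\to\mathbb{R}$ be a solution to the heat equation with initial value $u_0$. Let $f:(0,\infty)\to(0,\infty)$ be a monotone increasing function such that for each $r>0$ $$\int_0^T\sum_{x\in B_r}|u_t(x)|^2m(x)\,dt\le e^{f(r)}.$$ Assume further that the graph with $d$ is globally local with respect to $f$. Then there exist constants $r_0,D,E,F,G>1$ such that for all $r\ge r_0$ and all $0<\delta\le t<T$ with $$\delta\le\frac{r^2}{Df(Er)}$$ the following inequality holds: $$\sum_{x\in B_r}u_t^2(x)m(x)\le F\sum_{x\in B_{Er}}u_{t-\delta}^2(x)m(x)+\frac{Ge^{-f(Er)}}{r^2}.$$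
   Context: $X$ is a countable discrete set with a fixed reference vertex $o\in X$, and $m:X\to(0,\infty)$ is extended to a measure on all subsets of $X$ by additivity. A graph over $(X,m)$ is a symmetric map $b:X\times X\to[0,\infty)$ with $b(x,x)=0$ and $\sum_{y\in X}b(x,y)<\infty$ for all $x\in X$. Write $x\sim y$ if $b(x,y)>0$. A pseudo metric $d$ on $X$ is intrinsic if $\sum_{y\in X}b(x,y)d(x,y)^2\le m(x)$ for all $x\in X$. Distance balls: $B_r=\{y\in X\mid d(o,y)\le r\}$, $r\ge0$; "finite distance balls" means all $B_r$ are finite sets. Jump size: $s=\sup\{d(x,y)\mid x,y\in X,\ x\sim y\}$, and the jump size outside of $B_r$ is $s_r=\sup\{d(x,y)\mid x,y\in X,\ x\sim y,\ \min(d(x,o),d(y,o))\ge r\}$, $r\ge0$ (supremum of the empty set being $0$). The graph with pseudo metric $d$ is globally local with respect to a monotone increasing function $f:(0,\infty)\to(0,\infty)$ if $s<\infty$ and there is a constant $A>1$ with $\limsup_{r\to\infty}\frac{s_rf(Ar)}{r}<\infty$. Let $\mathcal{F}(X)=\{g:X\to\mathbb{R}\mid\sum_{y\in X}b(x,y)|g(y)|<\infty\text{ for all }x\in X\}$ and $\mathcal{L}g(x)=\frac{1}{m(x)}\sum_{y\in X}b(x,y)(g(x)-g(y))$ for $g\in\mathcal{F}(X)$. A function $u:(0,T)\times X\to\mathbb{R}$, with $u_t=u(t,\cdot)$, is a solution to the heat equation with initial value $u_0:X\to\mathbb{R}$ if $u_t\in\mathcal{F}(X)$ for every $t\in(0,T)$;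 for every $x\in X$ the function $t\mapsto u_t(x)$ is continuously differentiable on $(0,T)$ with $u_t(x)\to u_0(x)$ as $t\to0+$; and $\partial_tu=-\mathcal{L}u$ on $(0,T)\times X$. When $\delta=t$, $u_{t-\delta}$ is the initial value $u_0$. *)

theory Defs
  imports "HOL-Analysis.Analysis"
begin

text \<open>
  The countable discrete set is the universe of a type of class \<open>countable\<close>; the measure is given
  by its point weights \<open>m\<close>. A real family is \<open>summable_on\<close> a set iff it converges absolutely, and
  \<open>infsum\<close> of a non-summable family is 0, so summability is stated wherever the paper bounds a
  possibly divergent sum.
\<close>

definition graph_over :: "('a::countable \<Rightarrow> real) \<Rightarrow> ('a \<Rightarrow> 'a \<Rightarrow> real) \<Rightarrow> bool" where
  "graph_over m b \<longleftrightarrow>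
     (\<forall>x. m x > 0) \<and>
     (\<forall>x y. b x y \<ge> 0) \<and>
     (\<forall>x y. b x y = b y x) \<and>
     (\<forall>x. b x x = 0) \<and>
     (\<forall>x. (\<lambda>y. b x y) summable_on UNIV)"

definition adj :: "('a \<Rightarrow> 'a \<Rightarrow> real) \<Rightarrow> 'a \<Rightarrow> 'a \<Rightarrow> bool" where
  "adj b x y \<longleftrightarrow> b x y > 0"

definition pseudo_metric :: "('a \<Rightarrow> 'a \<Rightarrow> real) \<Rightarrow> bool" where
  "pseudo_metric d \<longleftrightarrow>
     (\<forall>x y. d x y \<ge> 0) \<and>
     (\<forall>x. d x x = 0) \<and>
     (\<forall>x y. d x y = d y x) \<and>
     (\<forall>x y z. d x z \<le> d x y + d y z)"

definition intrinsic ::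
  "('a::countable \<Rightarrow> real) \<Rightarrow> ('a \<Rightarrow> 'a \<Rightarrow> real) \<Rightarrow> ('a \<Rightarrow> 'a \<Rightarrow> real) \<Rightarrow> bool" where
  "intrinsic m b d \<longleftrightarrow>
     (\<forall>x. (\<lambda>y. b x y * (d x y)\<^sup>2) summable_on UNIV \<and>
          (\<Sum>\<^sub>\<infinity>y. b x y * (d x y)\<^sup>2) \<le> m x)"

definition dball :: "('a \<Rightarrow> 'a \<Rightarrow> real) \<Rightarrow> 'a \<Rightarrow> real \<Rightarrow> 'a set" where
  "dball d x0 r = {y. d x0 y \<le> r}"

definition finite_distance_balls :: "('a \<Rightarrow> 'a \<Rightarrow> real) \<Rightarrow> 'a \<Rightarrow> bool" where
  "finite_distance_balls d x0 \<longleftrightarrow> (\<forall>r\<ge>0. finite (dball d x0 r))"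

text \<open>
  Both jump sizes are suprema in \<open>[0, \<infinity>]\<close>; inserting 0 implements the convention that the
  supremum of the empty set is 0 and does not change any other supremum, as \<open>d \<ge> 0\<close>.
\<close>

definition jump_size :: "('a \<Rightarrow> 'a \<Rightarrow> real) \<Rightarrow> ('a \<Rightarrow> 'a \<Rightarrow> real) \<Rightarrow> ereal" where
  "jump_size b d = Sup (insert 0 {ereal (d x y) | x y. adj b x y})"

definition jump_size_outside ::
  "('a \<Rightarrow> 'a \<Rightarrow> real) \<Rightarrow> ('a \<Rightarrow> 'a \<Rightarrow> real) \<Rightarrow> 'a \<Rightarrow> real \<Rightarrow> ereal" where
  "jump_size_outside b d x0 r =
     Sup (insert 0 {ereal (d x y) | x y. adj b x y \<and> min (d x x0) (d y x0) \<ge> r})"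

definition globally_local ::
  "('a \<Rightarrow> 'a \<Rightarrow> real) \<Rightarrow> ('a \<Rightarrow> 'a \<Rightarrow> real) \<Rightarrow> 'a \<Rightarrow> (real \<Rightarrow> real) \<Rightarrow> bool" where
  "globally_local b d x0 f \<longleftrightarrow>
     jump_size b d < \<infinity> \<and>
     (\<exists>A>1. Limsup at_top (\<lambda>r. jump_size_outside b d x0 r * ereal (f (A * r)) / ereal r) < \<infinity>)"

definition formal_domain :: "('a::countable \<Rightarrow> 'a \<Rightarrow> real) \<Rightarrow> ('a \<Rightarrow> real) set" where
  "formal_domain b = {g. \<forall>x. (\<lambda>y. b x y * \<bar>g y\<bar>) summable_on UNIV}"

definition laplacian ::
  "('a::countable \<Rightarrow> real) \<Rightarrow> ('a \<Rightarrow> 'a \<Rightarrow> real) \<Rightarrow> ('a \<Rightarrow> real) \<Rightarrow> 'a \<Rightarrow> real" where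
  "laplacian m b g x = (1 / m x) * (\<Sum>\<^sub>\<infinity>y. b x y * (g x - g y))"

definition time_interval :: "ereal \<Rightarrow> real set" where
  "time_interval T = {t. 0 < t \<and> ereal t < T}"

definition heat_solution ::
  "('a::countable \<Rightarrow> real) \<Rightarrow> ('a \<Rightarrow> 'a \<Rightarrow> real) \<Rightarrow> ereal \<Rightarrow> ('a \<Rightarrow> real) \<Rightarrow> (real \<Rightarrow> 'a \<Rightarrow> real) \<Rightarrow> bool"
where
  "heat_solution m b T u0 u \<longleftrightarrow>
     (\<forall>t\<in>time_interval T. u t \<in> formal_domain b) \<and>
     (\<forall>x. (\<lambda>t. u t x) C1_differentiable_on time_interval T) \<and>
     (\<forall>x. ((\<lambda>t. u t x) \<longlongrightarrow> u0 x) (at_right 0)) \<and>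
     (\<forall>t\<in>time_interval T. \<forall>x. deriv (\<lambda>s. u s x) t = - laplacian m b (u t) x)"

text \<open>
  A solution is only constrained on \<open>(0, T)\<close>; this extends it to time 0 by its initial value.
\<close>

definition with_initial :: "('a \<Rightarrow> real) \<Rightarrow> (real \<Rightarrow> 'a \<Rightarrow> real) \<Rightarrow> real \<Rightarrow> 'a \<Rightarrow> real" where
  "with_initial u0 u t = (if t = 0 then u0 else u t)"

end

theory Submission
  imports Defs
begin

text \<open>
  The proof is an energy estimate with a weight whose front moves at finite speed. For a finitely
  supported \<open>h\<close> depending on time, differentiate \<open>\<Sum>x. u\<^sup>2 h\<^sup>2 m\<close> along the heat flow. On the
  edges, the identity
    \<open>(h\<^sub>x\<^sup>2 u\<^sub>x - h\<^sub>y\<^sup>2 u\<^sub>y) (u\<^sub>x - u\<^sub>y) = (h\<^sub>x u\<^sub>x - h\<^sub>y u\<^sub>y)\<^sup>2 - u\<^sub>x u\<^sub>y (h\<^sub>x - h\<^sub>y)\<^sup>2\<close>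
  discards a nonnegative square and leaves only \<open>\<Sum>x. u\<^sub>x\<^sup>2 \<Sum>y. b(x,y) (h\<^sub>x - h\<^sub>y)\<^sup>2\<close> to be
  controlled (\<open>caccioppoli_finite\<close>).

  Take \<open>h = \<eta> \<cdot> fade(\<kappa> (q - R) + \<beta> (s - s\<^sub>0))\<close>, where \<open>\<eta>\<close> is a spatial cutoff, \<open>q\<close> is the distance
  to \<open>x0\<close> and \<open>fade\<close> is a logistic function. As \<open>s\<close> grows, the region in which the weight is of
  order one recedes towards \<open>x0\<close> with speed \<open>\<beta> / \<kappa>\<close>. A logistic profile fits jumping processes:
  whenever \<open>\<kappa>\<close> times the jump length is bounded, the squared increment of \<open>fade\<close> along an edge is
  at most a constant times \<open>\<kappa>\<^sup>2 d\<^sup>2\<close> times the absolute derivative of \<open>fade\<^sup>2\<close> at one endpoint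
  (\<open>fade_diff_square_le\<close>), so that the intrinsic metric and a speed of order \<open>\<kappa>\<close> let the decay of the
  weight in time absorb its spatial variation. What remains comes from the cutoff
  (\<open>weighted_energy_derivative_le\<close>).

  With \<open>\<kappa>\<close> of order \<open>f(Ar)/r\<close>, three things fit together. Global locality makes \<open>\<kappa>\<close> times the jump
  length bounded away from the ball of radius \<open>r\<close>; near that ball, where jumps may be longer, \<open>q\<close>
  is replaced by a constant. Where the cutoff varies, the squared weight is below \<open>exp(-2 f(Ar))\<close>,
  which outweighs the bound \<open>exp(f(Ar))\<close> of the space-time integral of \<open>u\<^sup>2\<close> and leaves
  \<open>exp(-f(Ar))/r\<^sup>2\<close>. Finally, in time \<open>\<delta> \<le> r\<^sup>2/(D f(Ar))\<close> the front travels a distance of order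
  \<open>r/D\<close> and so does not reach the ball of radius \<open>r\<close>, on which the weight stays at least \<open>1/2\<close>.
\<close>

section \<open>The logistic weight\<close>

definition fade :: "real \<Rightarrow> real" where
  "fade z = 1 / (1 + exp z)"

lemma fade_bounds: "0 < fade z" "fade z \<le> 1" "fade z \<le> exp (- z)"
  "z \<le> 0 \<Longrightarrow> 1 / 2 \<le> fade z"
proof -
  show "0 < fade z" "fade z \<le> 1"
    by (simp_all add: fade_def add_pos_pos divide_simps)
  have "exp z * exp (- z) = 1" by (simp flip: exp_add)
  then show "fade z \<le> exp (- z)"
    by (simp add: fade_def divide_simps add_pos_pos algebra_simps)
  show "1 / 2 \<le> fade z" if "z \<le> 0"
  proof -
    have "exp z \<le> 1" using that by simp
    then show ?thesis by (simp add: fade_def divide_simps add_pos_pos)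
  qed
qed

text \<open>
  The last factor is, up to the constant \<open>-2\<close>, the derivative of \<open>fade\<^sup>2\<close>. The bound compares it at
  one endpoint only with an increment over a whole jump; this works because
  \<open>1 + exp z\<close> changes by a factor of at most \<open>exp K\<close> over a jump of size \<open>K\<close>.
\<close>

lemma fade_diff_square_le:
  assumes "\<bar>z - z'\<bar> \<le> K"
  shows "(fade z - fade z')\<^sup>2 \<le> exp (4 * K) * (z - z')\<^sup>2 * (exp z / (1 + exp z) ^ 3)"
proof -
  define p where "p = exp z"
  define q where "q = exp z'"
  have pq: "p > 0" "q > 0" by (auto simp: p_def q_def)
  have qp: "q \<le> exp K * p" and pq': "p \<le> exp K * q"
    using assms by (auto simp: p_def q_def simp flip: exp_add)
  have K: "1 \<le> exp K" using assms by auto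
  have low: "exp (- K) * (1 + p) \<le> 1 + q"
  proof -
    have "1 + p \<le> exp K * (1 + q)" using add_mono[OF K pq'] by (simp add: distrib_left)
    then show ?thesis by (simp add: exp_minus field_simps)
  qed
  have exp_diff: "exp y - exp x \<le> exp y * (y - x)" for x y :: real
  proof -
    have "1 + (x - y) \<le> exp (x - y)" by (rule exp_ge_add_one_self)
    then have "exp y * (1 + (x - y)) \<le> exp y * exp (x - y)" by simp
    also have "\<dots> = exp x" by (simp flip: exp_add)
    finally show ?thesis by (simp add: algebra_simps)
  qed
  have num: "\<bar>q - p\<bar> \<le> exp K * p * \<bar>z - z'\<bar>"
  proof (cases "z \<le> z'")
    case True
    have "q - p \<le> q * (z' - z)" unfolding p_def q_def by (rule exp_diff)
    also have "\<dots> \<le> exp K * p * (z' - z)" using True qp by (intro mult_right_mono) auto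
    finally show ?thesis using True by (simp add: p_def q_def)
  next
    case False
    have "p - q \<le> 1 * p * (z - z')" using exp_diff[of z z'] by (simp add: p_def q_def)
    also have "\<dots> \<le> exp K * p * (z - z')"
      using False K pq by (intro mult_right_mono) auto
    finally show ?thesis using False by (simp add: p_def q_def)
  qed
  have "\<bar>fade z - fade z'\<bar> = \<bar>q - p\<bar> / ((1 + p) * (1 + q))"
    using pq by (simp add: fade_def p_def[symmetric] q_def[symmetric] diff_frac_eq abs_mult add_pos_pos
      add_nonneg_eq_0_iff)
  also have "\<dots> \<le> (exp K * p * \<bar>z - z'\<bar>) / ((1 + p) * (exp (- K) * (1 + p)))"
    using num low pq by (intro frac_le mult_left_mono mult_pos_pos) auto
  also have "\<dots> = exp (2 * K) * \<bar>z - z'\<bar> * (p / (1 + p)\<^sup>2)"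
    using pq by (simp add: exp_minus exp_double divide_simps power2_eq_square)
  finally have "\<bar>fade z - fade z'\<bar>\<^sup>2 \<le> (exp (2 * K) * \<bar>z - z'\<bar> * (p / (1 + p)\<^sup>2))\<^sup>2"
    by (intro power_mono) auto
  also have "\<dots> = exp (4 * K) * (z - z')\<^sup>2 * (p\<^sup>2 / (1 + p) ^ 4)"
    by (simp add: power_mult_distrib power_divide flip: exp_of_nat_mult)
  \<comment> \<open>\<open>p / (1 + p) \<le> 1\<close>: half of the exponential decay of the squared increment is given away,
     as the derivative of \<open>fade\<^sup>2\<close> is only of order \<open>p\<close> where \<open>p\<close> is small\<close>
  also have "p\<^sup>2 / (1 + p) ^ 4 \<le> p / (1 + p) ^ 3"
    using pq by (simp add: divide_simps power_numeral_reduce add_pos_pos)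
  finally show ?thesis
    by (simp add: p_def mult_left_mono)
qed

lemma fade_square_has_derivative:
  "((\<lambda>s. (fade (a + c * s))\<^sup>2) has_real_derivative
     - 2 * c * (exp (a + c * s) / (1 + exp (a + c * s)) ^ 3)) (at s)"
proof -
  define q where "q = exp (a + c * s)"
  have q: "1 + q > 0" by (simp add: q_def add_pos_pos)
  have "((\<lambda>s. inverse (1 + exp (a + c * s))) has_real_derivative
      - (inverse (1 + q) * (c * q) * inverse (1 + q))) (at s)"
    using q by (auto intro!: derivative_eq_intros simp: q_def mult.commute)
  from DERIV_power[OF this, of 2]
  have "((\<lambda>s. (fade (a + c * s))\<^sup>2) has_real_derivative
      2 * (inverse (1 + q) * - (inverse (1 + q) * (c * q) * inverse (1 + q)))) (at s)"
    by (simp add: fade_def inverse_eq_divide q_def mult_ac)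
  moreover have "2 * (inverse (1 + q) * - (inverse (1 + q) * (c * q) * inverse (1 + q)))
      = - 2 * c * (q / (1 + q) ^ 3)"
    using q by (simp add: divide_inverse power_numeral_reduce mult_ac)
  ultimately show ?thesis by (simp add: q_def)
qed

section \<open>Energy estimates along the heat flow\<close>

text \<open>
  A Caccioppoli inequality in which the energy of \<open>h g\<close> is dropped. Since the product rule is used
  in the exact form
  \<open>(h\<^sub>x\<^sup>2 g\<^sub>x - h\<^sub>y\<^sup>2 g\<^sub>y) (g\<^sub>x - g\<^sub>y) = (h\<^sub>x g\<^sub>x - h\<^sub>y g\<^sub>y)\<^sup>2 - g\<^sub>x g\<^sub>y (h\<^sub>x - h\<^sub>y)\<^sup>2\<close>,
  the gradient of \<open>g\<close> never has to be absorbed.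
\<close>

lemma caccioppoli_finite:
  fixes b :: "'a \<Rightarrow> 'a \<Rightarrow> real" and g h :: "'a \<Rightarrow> real"
  assumes nonneg: "\<And>x y. b x y \<ge> 0" and sym: "\<And>x y. b x y = b y x"
  shows "- 2 * (\<Sum>x\<in>V. (h x)\<^sup>2 * g x * (\<Sum>y\<in>V. b x y * (g x - g y)))
          \<le> (\<Sum>x\<in>V. (g x)\<^sup>2 * (\<Sum>y\<in>V. b x y * (h x - h y)\<^sup>2))"
proof -
  have swap: "(\<Sum>x\<in>V. \<Sum>y\<in>V. b x y * F y x) = (\<Sum>x\<in>V. \<Sum>y\<in>V. b x y * F x y)" for F
    by (subst sum.swap) (simp add: sym)
  have "2 * (\<Sum>x\<in>V. (h x)\<^sup>2 * g x * (\<Sum>y\<in>V. b x y * (g x - g y)))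
      = (\<Sum>x\<in>V. \<Sum>y\<in>V. b x y * ((h x)\<^sup>2 * g x * (g x - g y)))
        + (\<Sum>x\<in>V. \<Sum>y\<in>V. b x y * ((h y)\<^sup>2 * g y * (g y - g x)))"
    by (subst swap[of "\<lambda>x y. (h x)\<^sup>2 * g x * (g x - g y)"])
       (simp add: sum_distrib_left sum_distrib_right mult_ac)
  also have "\<dots> = (\<Sum>x\<in>V. \<Sum>y\<in>V. b x y * ((h x * g x - h y * g y)\<^sup>2 - g x * g y * (h x - h y)\<^sup>2))"
    by (simp add: sum.distrib[symmetric] algebra_simps power2_eq_square)
  finally have "- 2 * (\<Sum>x\<in>V. (h x)\<^sup>2 * g x * (\<Sum>y\<in>V. b x y * (g x - g y)))
      = (\<Sum>x\<in>V. \<Sum>y\<in>V. b x y * (g x * g y * (h x - h y)\<^sup>2 - (h x * g x - h y * g y)\<^sup>2))"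
    by (simp add: sum_negf[symmetric] algebra_simps)
  also have "\<dots> \<le> (\<Sum>x\<in>V. \<Sum>y\<in>V. b x y * (((g x)\<^sup>2 / 2 + (g y)\<^sup>2 / 2) * (h x - h y)\<^sup>2))"
  proof (intro sum_mono mult_left_mono nonneg)
    fix x y
    have "g x * g y \<le> (g x)\<^sup>2 / 2 + (g y)\<^sup>2 / 2"
      using sum_squares_bound[of "g x" "g y"] by simp
    then have "g x * g y * (h x - h y)\<^sup>2 \<le> ((g x)\<^sup>2 / 2 + (g y)\<^sup>2 / 2) * (h x - h y)\<^sup>2"
      by (intro mult_right_mono) auto
    then show "g x * g y * (h x - h y)\<^sup>2 - (h x * g x - h y * g y)\<^sup>2
        \<le> ((g x)\<^sup>2 / 2 + (g y)\<^sup>2 / 2) * (h x - h y)\<^sup>2"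
      using zero_le_power2[of "h x * g x - h y * g y"] by linarith
  qed
  also have "\<dots> = (\<Sum>x\<in>V. \<Sum>y\<in>V. b x y * ((g x)\<^sup>2 / 2 * (h x - h y)\<^sup>2))
        + (\<Sum>x\<in>V. \<Sum>y\<in>V. b x y * ((g y)\<^sup>2 / 2 * (h y - h x)\<^sup>2))"
    by (simp add: sum.distrib[symmetric] algebra_simps power2_commute)
  also have "\<dots> = (\<Sum>x\<in>V. (g x)\<^sup>2 * (\<Sum>y\<in>V. b x y * (h x - h y)\<^sup>2))"
    by (subst swap[of "\<lambda>x y. (g x)\<^sup>2 / 2 * (h x - h y)\<^sup>2"])
       (simp add: sum_distrib_left sum.distrib[symmetric] mult_ac)
  finally show ?thesis .
qed

lemma intrinsic_finite_sum:
  assumes "graph_over m b" "intrinsic m b d" "finite V"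
  shows "(\<Sum>y\<in>V. b x y * (d x y)\<^sup>2) \<le> m x"
proof -
  have "(\<Sum>y\<in>V. b x y * (d x y)\<^sup>2) \<le> (\<Sum>\<^sub>\<infinity>y. b x y * (d x y)\<^sup>2)"
    using assms by (intro finite_sum_le_infsum) (auto simp: graph_over_def intrinsic_def)
  also have "\<dots> \<le> m x" using assms by (simp add: intrinsic_def)
  finally show ?thesis .
qed

lemma heat_solution_has_derivative:
  assumes "heat_solution m b T u0 u" "s \<in> time_interval T"
  shows "((\<lambda>s. u s x) has_real_derivative - laplacian m b (u s) x) (at s)"
proof -
  obtain D where "((\<lambda>s. u s x) has_vector_derivative D s) (at s)"
    using assms unfolding heat_solution_def C1_differentiable_on_def by blast
  then have "((\<lambda>s. u s x) has_real_derivative D s) (at s)"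
    by (simp add: has_real_derivative_iff_has_vector_derivative)
  moreover from DERIV_imp_deriv[OF this] have "D s = - laplacian m b (u s) x"
    using assms unfolding heat_solution_def by metis
  ultimately show ?thesis by simp
qed

lemma laplacian_finite_sum:
  assumes "finite V" "\<And>y. y \<notin> V \<Longrightarrow> b x y = 0"
  shows "laplacian m b g x = (\<Sum>y\<in>V. b x y * (g x - g y)) / m x"
proof -
  have "(\<Sum>\<^sub>\<infinity>y. b x y * (g x - g y)) = (\<Sum>\<^sub>\<infinity>y\<in>V. b x y * (g x - g y))"
    using assms by (intro infsum_cong_neutral) auto
  then show ?thesis using assms by (simp add: laplacian_def)
qed

text \<open>
  The assumption on \<open>\<beta>\<close> says that the front moves fast enough for the decay of the weight in time
  to outweigh its gradient. Only edges on which the cutoff \<open>\<eta>\<close> varies then contribute, and \<open>M\<close>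
  bounds the squared weight on these. Since \<open>V\<close> contains every vertex of the support of \<open>\<eta>\<close> that
  has a neighbour, together with its neighbours, all sums in the computation are finite.
\<close>

lemma weighted_energy_derivative_le:
  fixes m :: "'a::countable \<Rightarrow> real" and b d :: "'a \<Rightarrow> 'a \<Rightarrow> real"
    and u :: "real \<Rightarrow> 'a \<Rightarrow> real" and \<eta> \<theta> :: "'a \<Rightarrow> real"
  assumes graph: "graph_over m b" and intr: "intrinsic m b d"
    and sol: "heat_solution m b T u0 u" and s: "s \<in> time_interval T"
    and fin: "finite V"
    and nbr: "\<And>x y. \<lbrakk>\<eta> x \<noteq> 0; adj b x y\<rbrakk> \<Longrightarrow> x \<in> V \<and> y \<in> V"
    and lip: "\<And>x y. adj b x y \<Longrightarrow> \<bar>\<theta> x - \<theta> y\<bar> \<le> \<kappa> * d x y"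
    and jump: "\<And>x y. adj b x y \<Longrightarrow> \<bar>\<theta> x - \<theta> y\<bar> \<le> K"
    and speed: "exp (4 * K) * \<kappa>\<^sup>2 \<le> \<beta>"
    and cut_lip: "\<And>x y. adj b x y \<Longrightarrow> \<bar>\<eta> x - \<eta> y\<bar> \<le> L * d x y"
    and cut_small: "\<And>x y. \<lbrakk>adj b x y; \<eta> x \<noteq> \<eta> y\<rbrakk> \<Longrightarrow> (fade (\<theta> y + \<beta> * s))\<^sup>2 \<le> M"
    and M: "M \<ge> 0"
  shows "\<exists>D. ((\<lambda>s. \<Sum>x\<in>V. (u s x)\<^sup>2 * (\<eta> x * fade (\<theta> x + \<beta> * s))\<^sup>2 * m x)
               has_real_derivative D) (at s)
           \<and> D \<le> 2 * L\<^sup>2 * M * (\<Sum>x\<in>V. (u s x)\<^sup>2 * m x)"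
proof -
  define g where "g = u s"
  define \<phi> where "\<phi> x = fade (\<theta> x + \<beta> * s)" for x
  define h where "h x = \<eta> x * \<phi> x" for x
  define E where "E x = exp (\<theta> x + \<beta> * s) / (1 + exp (\<theta> x + \<beta> * s)) ^ 3" for x
  define P where "P x = (\<Sum>y\<in>V. b x y * (g x - g y))" for x
  have m: "m x > 0" and nonneg: "b x y \<ge> 0" and sym: "b x y = b y x" for x y
    using graph by (auto simp: graph_over_def)
  have nadj: "b x y = 0" if "\<not> adj b x y" for x y
    using that nonneg[of x y] by (simp add: adj_def)
  have E: "E x \<ge> 0" for x by (simp add: E_def)
  have intr': "(\<Sum>y\<in>V. b x y * (d x y)\<^sup>2) \<le> m x" for x
    by (rule intrinsic_finite_sum[OF graph intr fin])
  let ?D = "(\<Sum>x\<in>V. (- 2 * ((h x)\<^sup>2 * g x * P x) - 2 * \<beta> * ((g x)\<^sup>2 * (\<eta> x)\<^sup>2 * E x * m x)))"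
  have "((\<lambda>s. (u s x)\<^sup>2 * (\<eta> x * fade (\<theta> x + \<beta> * s))\<^sup>2 * m x) has_real_derivative
      - 2 * ((h x)\<^sup>2 * g x * P x) - 2 * \<beta> * ((g x)\<^sup>2 * (\<eta> x)\<^sup>2 * E x * m x)) (at s)" for x
  proof (cases "\<eta> x = 0")
    case True
    then show ?thesis by (simp add: h_def)
  next
    case False
    have "laplacian m b (u s) x = P x / m x"
      unfolding P_def g_def using nbr[OF False] nadj by (intro laplacian_finite_sum fin) blast
    then have "((\<lambda>s. u s x) has_real_derivative - (P x / m x)) (at s)"
      using heat_solution_has_derivative[OF sol s, of x] by simp
    from DERIV_power[OF this, of 2]
    have du: "((\<lambda>s. (u s x)\<^sup>2) has_real_derivative 2 * (g x * - (P x / m x))) (at s)"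
      by (simp add: g_def mult_ac)
    have dw: "((\<lambda>s. (fade (\<theta> x + \<beta> * s))\<^sup>2) has_real_derivative - 2 * \<beta> * E x) (at s)"
      unfolding E_def by (rule fade_square_has_derivative)
    have "((\<lambda>s. (u s x)\<^sup>2 * (fade (\<theta> x + \<beta> * s))\<^sup>2 * ((\<eta> x)\<^sup>2 * m x)) has_real_derivative
        (2 * (g x * - (P x / m x)) * (\<phi> x)\<^sup>2 + - 2 * \<beta> * E x * (g x)\<^sup>2) * ((\<eta> x)\<^sup>2 * m x)) (at s)"
      using DERIV_cmult_right[OF DERIV_mult[OF du dw], of "(\<eta> x)\<^sup>2 * m x"]
      by (simp add: g_def \<phi>_def)
    moreover have "(2 * (g x * - (P x / m x)) * (\<phi> x)\<^sup>2 + - 2 * \<beta> * E x * (g x)\<^sup>2) * ((\<eta> x)\<^sup>2 * m x)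
      = - 2 * ((h x)\<^sup>2 * g x * P x) - 2 * \<beta> * ((g x)\<^sup>2 * (\<eta> x)\<^sup>2 * E x * m x)"
      using m[of x] by (simp add: h_def field_simps)
    ultimately show ?thesis by (simp add: power_mult_distrib mult_ac)
  qed
  then have deriv: "((\<lambda>s. \<Sum>x\<in>V. (u s x)\<^sup>2 * (\<eta> x * fade (\<theta> x + \<beta> * s))\<^sup>2 * m x)
      has_real_derivative ?D) (at s)"
    by (intro DERIV_sum)
  have edge: "b x y * (h x - h y)\<^sup>2
      \<le> 2 * (\<eta> x)\<^sup>2 * \<beta> * E x * (b x y * (d x y)\<^sup>2) + 2 * L\<^sup>2 * M * (b x y * (d x y)\<^sup>2)" for x y
  proof (cases "adj b x y")
    case True
    \<comment> \<open>an asymmetric Leibniz rule: the variation of \<open>\<phi>\<close> must come with \<open>\<eta> x\<close>, as the decay in time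
       that absorbs it is available at \<open>x\<close> only\<close>
    have "(h x - h y)\<^sup>2 = (\<eta> x * (\<phi> x - \<phi> y) + \<phi> y * (\<eta> x - \<eta> y))\<^sup>2"
      by (simp add: h_def algebra_simps)
    also have "\<dots> \<le> 2 * (\<eta> x * (\<phi> x - \<phi> y))\<^sup>2 + 2 * (\<phi> y * (\<eta> x - \<eta> y))\<^sup>2"
      using zero_le_power2[of "\<eta> x * (\<phi> x - \<phi> y) - \<phi> y * (\<eta> x - \<eta> y)"]
      unfolding power2_sum power2_diff by linarith
    also have "(\<eta> x * (\<phi> x - \<phi> y))\<^sup>2 \<le> (\<eta> x)\<^sup>2 * (\<beta> * (d x y)\<^sup>2 * E x)"
    proof -
      have "(\<phi> x - \<phi> y)\<^sup>2 \<le> exp (4 * K) * (\<theta> x - \<theta> y)\<^sup>2 * E x"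
        using fade_diff_square_le[of "\<theta> x + \<beta> * s" "\<theta> y + \<beta> * s" K] jump[OF True]
        by (simp add: \<phi>_def E_def)
      also have "\<dots> \<le> exp (4 * K) * (\<kappa> * d x y)\<^sup>2 * E x"
        using power_mono[OF lip[OF True], of 2] E by (intro mult_right_mono mult_left_mono) auto
      also have "\<dots> = exp (4 * K) * \<kappa>\<^sup>2 * ((d x y)\<^sup>2 * E x)" by (simp add: power_mult_distrib)
      also have "\<dots> \<le> \<beta> * ((d x y)\<^sup>2 * E x)" using E speed by (intro mult_right_mono) auto
      finally show ?thesis by (simp add: power_mult_distrib mult_left_mono)
    qed
    also have "(\<phi> y * (\<eta> x - \<eta> y))\<^sup>2 \<le> M * (L * d x y)\<^sup>2"
    proof (cases "\<eta> x = \<eta> y")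
      case True
      then show ?thesis using M by simp
    next
      case False
      then show ?thesis
        using cut_small[OF True False] power_mono[OF cut_lip[OF True], of 2] M
        unfolding power_mult_distrib[of "\<phi> y"] by (intro mult_mono) (auto simp: \<phi>_def)
    qed
    finally have "(h x - h y)\<^sup>2
        \<le> 2 * ((\<eta> x)\<^sup>2 * (\<beta> * (d x y)\<^sup>2 * E x)) + 2 * (M * (L * d x y)\<^sup>2)" by simp
    from mult_left_mono[OF this nonneg[of x y]] show ?thesis
      by (simp add: power_mult_distrib algebra_simps)
  qed (simp add: nadj)
  have vertex: "(\<Sum>y\<in>V. b x y * (h x - h y)\<^sup>2)
      \<le> 2 * \<beta> * ((\<eta> x)\<^sup>2 * E x * m x) + 2 * L\<^sup>2 * M * m x" for x
  proof -
    have \<beta>: "\<beta> \<ge> 0" using speed by (rule order_trans[rotated]) simp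
    let ?c = "2 * (\<eta> x)\<^sup>2 * \<beta> * E x + 2 * L\<^sup>2 * M"
    have "(\<Sum>y\<in>V. b x y * (h x - h y)\<^sup>2) \<le> (\<Sum>y\<in>V. ?c * (b x y * (d x y)\<^sup>2))"
      using edge by (intro sum_mono) (simp add: distrib_right)
    also have "\<dots> = ?c * (\<Sum>y\<in>V. b x y * (d x y)\<^sup>2)" by (simp add: sum_distrib_left)
    also have "\<dots> \<le> ?c * m x" using intr' \<beta> E M by (intro mult_left_mono) auto
    finally show ?thesis by (simp add: algebra_simps)
  qed
  have "- 2 * (\<Sum>x\<in>V. (h x)\<^sup>2 * g x * P x) \<le> (\<Sum>x\<in>V. (g x)\<^sup>2 * (\<Sum>y\<in>V. b x y * (h x - h y)\<^sup>2))"
    unfolding P_def by (rule caccioppoli_finite[OF nonneg sym])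
  also have "\<dots> \<le> (\<Sum>x\<in>V. (g x)\<^sup>2 * (2 * \<beta> * ((\<eta> x)\<^sup>2 * E x * m x) + 2 * L\<^sup>2 * M * m x))"
    using vertex by (intro sum_mono mult_left_mono) auto
  also have "\<dots> = 2 * \<beta> * (\<Sum>x\<in>V. (g x)\<^sup>2 * (\<eta> x)\<^sup>2 * E x * m x) + 2 * L\<^sup>2 * M * (\<Sum>x\<in>V. (g x)\<^sup>2 * m x)"
    by (simp add: sum.distrib[symmetric] sum_distrib_left algebra_simps)
  finally have "?D \<le> 2 * L\<^sup>2 * M * (\<Sum>x\<in>V. (u s x)\<^sup>2 * m x)"
    by (simp add: sum_subtractf sum_distrib_left g_def sum_negf)
  with deriv show ?thesis by blast
qed

text \<open>
  This turns a differential inequality into an energy bound when the rate is controlled only by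
  its integral over a larger time set: positivity of \<open>\<Psi>\<close> allows restricting to \<open>[a, t]\<close>.
\<close>

lemma growth_le_nn_integral_rate:
  fixes \<Phi> \<Psi> :: "real \<Rightarrow> real"
  assumes "a \<le> t" and I: "{a..t} \<subseteq> I"
    and deriv: "\<And>s. s \<in> {a..t} \<Longrightarrow> \<exists>D. (\<Phi> has_real_derivative D) (at s) \<and> D \<le> c * \<Psi> s"
    and cont: "continuous_on {a..t} \<Psi>" and nonneg: "\<And>s. \<Psi> s \<ge> 0" and c: "c \<ge> 0"
    and int: "(\<integral>\<^sup>+s\<in>I. ennreal (\<Psi> s) \<partial>lborel) \<le> ennreal B" and B: "B \<ge> 0"
  shows "\<Phi> t \<le> \<Phi> a + c * B"
proof -
  obtain D where D: "\<And>s. s \<in> {a..t} \<Longrightarrow> (\<Phi> has_real_derivative D s) (at s)"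
    "\<And>s. s \<in> {a..t} \<Longrightarrow> D s \<le> c * \<Psi> s"
    using deriv by metis
  have D_integral: "(D has_integral (\<Phi> t - \<Phi> a)) {a..t}"
    using D(1) \<open>a \<le> t\<close> by (intro fundamental_theorem_of_calculus)
      (auto simp: has_real_derivative_iff_has_vector_derivative[symmetric] intro: has_field_derivative_at_within)
  have \<Psi>: "(\<Psi> has_integral integral {a..t} \<Psi>) {a..t}"
    by (intro integrable_integral integrable_continuous_interval cont)
  have "\<Phi> t - \<Phi> a \<le> c * integral {a..t} \<Psi>"
    by (rule has_integral_le[OF D_integral has_integral_mult_right[OF \<Psi>] D(2)])
  moreover have "integral {a..t} \<Psi> \<le> B"
  proof -
    have "(\<integral>\<^sup>+s\<in>{a..t}. ennreal (\<Psi> s) \<partial>lborel) = ennreal (integral {a..t} \<Psi>)"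
      by (rule nn_integral_has_integral_lebesgue'[OF nonneg \<Psi>])
    moreover have "(\<integral>\<^sup>+s\<in>{a..t}. ennreal (\<Psi> s) \<partial>lborel)
        \<le> (\<integral>\<^sup>+s\<in>I. ennreal (\<Psi> s) \<partial>lborel)"
      using I by (intro nn_integral_mono) (auto simp: indicator_def)
    ultimately have "ennreal (integral {a..t} \<Psi>) \<le> ennreal B" using int by (auto intro: order_trans)
    then show ?thesis using B by simp
  qed
  from mult_left_mono[OF this c] have "c * integral {a..t} \<Psi> \<le> c * B" .
  ultimately show ?thesis by linarith
qed


section \<open>The local energy inequality\<close>

lemma jump_size_finiteE:
  assumes "jump_size b d < \<infinity>"
  obtains S where "S \<ge> 0" "\<And>x y. adj b x y \<Longrightarrow> d x y \<le> S"
proof -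
  have up: "ereal (d x y) \<le> jump_size b d" if "adj b x y" for x y
    unfolding jump_size_def using that by (intro Sup_upper) auto
  have "0 \<le> jump_size b d" unfolding jump_size_def by (intro Sup_upper) auto
  then show ?thesis
    using assms up that[of "real_of_ereal (jump_size b d)"]
    by (cases "jump_size b d") auto
qed

text \<open>
  The vertices are kept at distance at least \<open>r\<close> while \<open>f\<close> is evaluated at \<open>A r\<close>: this is the room
  in which the weight decays from order one to \<open>exp(- f (A r))\<close>.
\<close>

lemma globally_localE:
  assumes "globally_local b d x0 f" and fpos: "\<And>r. r > 0 \<Longrightarrow> f r > 0"
  obtains A C r1 where "A > 1" "C \<ge> 0"
    "\<And>r x y. r \<ge> r1 \<Longrightarrow> r > 0 \<Longrightarrow> adj b x y \<Longrightarrow> d x x0 \<ge> r \<Longrightarrow> d y x0 \<ge> r \<Longrightarrow> d x y * f (A * r) \<le> C * r"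
proof -
  let ?q = "\<lambda>A r. jump_size_outside b d x0 r * ereal (f (A * r)) / ereal r"
  obtain A where A: "A > 1" and lim: "Limsup at_top (?q A) < \<infinity>"
    using assms unfolding globally_local_def by auto
  obtain c where c: "Limsup at_top (?q A) < ereal c"
    using lim less_PInf_Ex_of_nat by (metis real_of_ereal_ord_simps ereal_dense2)
  have "\<forall>\<^sub>F r in at_top. ?q A r < ereal c"
    using c by (rule Limsup_lessD)
  then obtain r1 where r1: "\<And>r. r \<ge> r1 \<Longrightarrow> ?q A r < ereal c"
    by (auto simp: eventually_at_top_linorder)
  have "d x y * f (A * r) \<le> max c 0 * r"
    if "r \<ge> r1" "r > 0" "adj b x y" "d x x0 \<ge> r" "d y x0 \<ge> r" for r x y
  proof -
    have f: "f (A * r) > 0" using A that fpos by simp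
    have "ereal (d x y) \<le> jump_size_outside b d x0 r"
      unfolding jump_size_outside_def using that by (intro Sup_upper) auto
    then have "ereal (d x y) * ereal (f (A * r)) / ereal r \<le> ?q A r"
      using f that by (intro ereal_divide_right_mono ereal_mult_right_mono) auto
    also have "\<dots> < ereal c" using r1 that by auto
    finally have "d x y * f (A * r) / r < c" using that by simp
    then have "d x y * f (A * r) \<le> c * r" using that by (simp add: field_simps)
    also have "\<dots> \<le> max c 0 * r" using that by simp
    finally show ?thesis .
  qed
  then show ?thesis using that[of A "max c 0" r1] A by auto
qed


definition cutoff :: "real \<Rightarrow> real \<Rightarrow> real \<Rightarrow> real" where
  "cutoff R W p = max 0 (min 1 ((R - p) / W))"

lemma cutoff_bounds: "0 \<le> cutoff R W p" "cutoff R W p \<le> 1"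
  by (auto simp: cutoff_def)

lemma cutoff_eq_1: "W > 0 \<Longrightarrow> p \<le> R - W \<Longrightarrow> cutoff R W p = 1"
  by (auto simp: cutoff_def min_def max_def field_simps)

lemma cutoff_eq_0: "W > 0 \<Longrightarrow> R \<le> p \<Longrightarrow> cutoff R W p = 0"
  by (auto simp: cutoff_def min_def max_def field_simps)

lemma cutoff_lipschitz:
  assumes "W > 0"
  shows "\<bar>cutoff R W p - cutoff R W q\<bar> \<le> 1 / W * \<bar>p - q\<bar>"
proof -
  have "\<bar>cutoff R W p - cutoff R W q\<bar> \<le> \<bar>(R - p) / W - (R - q) / W\<bar>"
    unfolding cutoff_def by linarith
  also have "\<dots> = 1 / W * \<bar>p - q\<bar>"
    using assms by (simp add: diff_divide_distrib[symmetric] abs_minus_commute)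
  finally show ?thesis .
qed

theorem lemma2p4:
  fixes m :: "'a::countable \<Rightarrow> real"
    and b d :: "'a \<Rightarrow> 'a \<Rightarrow> real"
    and x0 :: 'a
    and T :: ereal
    and u :: "real \<Rightarrow> 'a \<Rightarrow> real"
    and u0 :: "'a \<Rightarrow> real"
    and f :: "real \<Rightarrow> real"
  assumes "graph_over m b"
    and "pseudo_metric d"
    and "intrinsic m b d"
    and "finite_distance_balls d x0"
    and "jump_size b d < \<infinity>"
    and "0 < T"
    and "heat_solution m b T u0 u"
    and "\<And>r. r > 0 \<Longrightarrow> f r > 0"
    and "mono_on {0<..} f"
    and "\<And>r. r > 0 \<Longrightarrow>
           (\<integral>\<^sup>+t\<in>time_interval T. ennreal (\<Sum>x\<in>dball d x0 r. \<bar>u t x\<bar>\<^sup>2 * m x) \<partial>lborel)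
             \<le> ennreal (exp (f r))"
    and "globally_local b d x0 f"
  shows "\<exists>r0 D E F G :: real. r0 > 1 \<and> D > 1 \<and> E > 1 \<and> F > 1 \<and> G > 1 \<and>
           (\<forall>r\<ge>r0. \<forall>\<delta> t. 0 < \<delta> \<and> \<delta> \<le> t \<and> ereal t < T \<and> \<delta> \<le> r\<^sup>2 / (D * f (E * r)) \<longrightarrow>
              (\<Sum>x\<in>dball d x0 r. (u t x)\<^sup>2 * m x)
                \<le> F * (\<Sum>x\<in>dball d x0 (E * r). (with_initial u0 u (t - \<delta>) x)\<^sup>2 * m x)
                  + G * exp (- f (E * r)) / r\<^sup>2)"
proof -
  have m: "m x > 0" for x
    using assms(1) by (simp add: graph_over_def)
  have dsym: "d x y = d y x" and tri: "d x z \<le> d x y + d y z" for x y z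
    using assms(2) by (auto simp: pseudo_metric_def)
  obtain S where S: "S \<ge> 0" and dS: "\<And>x y. adj b x y \<Longrightarrow> d x y \<le> S"
    using jump_size_finiteE[OF assms(5)] by blast
  obtain A C r1 where A: "A > 1" and C: "C \<ge> 0" and local:
    "\<And>r x y. \<lbrakk>r \<ge> r1; r > 0; adj b x y; d x x0 \<ge> r; d y x0 \<ge> r\<rbrakk> \<Longrightarrow> d x y * f (A * r) \<le> C * r"
    using globally_localE[OF assms(11,8)] by metis
  \<comment> \<open>With slope \<open>\<kappa> = 4 f(A r) / ((A - 1) r)\<close>, \<open>K\<close> bounds \<open>\<kappa>\<close> times the length of a jump outside
     radius \<open>r\<close>; the front then has speed \<open>exp (4 K) \<kappa>\<close>, and \<open>D\<close> keeps its path shorter than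
     \<open>(A - 1) r / 8\<close>. The summands 2 only make the constants exceed 1.\<close>
  define K where "K = 4 * C / (A - 1)"
  define D where "D = 2 + 32 * exp (4 * K) / (A - 1)\<^sup>2"
  define G where "G = 2 + 128 / (A - 1)\<^sup>2"
  define r0 where "r0 = max (max 2 r1) (8 * S / (A - 1))"
  have D: "D > 1" and G: "G > 1" and r0: "r0 > 1"
    using A by (auto simp: D_def G_def r0_def add_pos_nonneg intro: add_strict_increasing2)
  have DA: "32 * exp (4 * K) \<le> D * (A - 1)\<^sup>2"
    using A by (simp add: D_def field_simps)

  have main: "(\<Sum>x\<in>dball d x0 r. (u t x)\<^sup>2 * m x)
      \<le> 4 * (\<Sum>x\<in>dball d x0 (A * r). (with_initial u0 u (t - \<delta>) x)\<^sup>2 * m x)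
        + G * exp (- f (A * r)) / r\<^sup>2"
    if r: "r \<ge> r0" and \<delta>: "0 < \<delta>" "\<delta> \<le> t" and tT: "ereal t < T"
      and \<delta>r: "\<delta> \<le> r\<^sup>2 / (D * f (A * r))" for r \<delta> t
  proof -
    \<comment> \<open>The annulus between \<open>r\<close> and \<open>A r = r + w\<close> is divided as follows: the weight has its front
       initially at \<open>r + w/4\<close>, the cutoff decreases from 1 to 0 between \<open>r + 5w/8\<close> and \<open>r + 7w/8\<close>,
       and the remaining margins accommodate single jumps, as \<open>S \<le> w/8\<close>, and the motion of the
       front. The slope \<open>\<kappa>\<close> makes the weight decay by \<open>exp (- f0)\<close> over a distance \<open>w/4\<close>.\<close>
    define w where "w = (A - 1) * r"
    define f0 where "f0 = f (A * r)"
    define \<kappa> where "\<kappa> = 4 * f0 / w"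
    define \<beta> where "\<beta> = exp (4 * K) * \<kappa>\<^sup>2"
    define \<rho> where "\<rho> x = d x0 x" for x
    \<comment> \<open>an edge meeting the open ball of radius \<open>r\<close> has both ends within \<open>r + S\<close>, where \<open>q\<close> is
       constant; all other edges are short by global locality\<close>
    define q where "q x = max (\<rho> x) (r + S)" for x
    define \<theta> where "\<theta> x = \<kappa> * (q x - (r + w / 4)) - \<beta> * (t - \<delta>)" for x
    define \<eta> where "\<eta> x = cutoff (r + 7 * w / 8) (w / 4) (\<rho> x)" for x
    define V where "V = dball d x0 (A * r)"
    define \<Phi> where "\<Phi> s = (\<Sum>x\<in>V. (u s x)\<^sup>2 * (\<eta> x * fade (\<theta> x + \<beta> * s))\<^sup>2 * m x)" for s
    define \<Psi> where "\<Psi> s = (\<Sum>x\<in>V. (u s x)\<^sup>2 * m x)" for s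
    have rpos: "r > 0" and "r \<ge> r1" and w: "w > 0" using r A by (auto simp: r0_def w_def)
    have Sw: "S \<le> w / 8" using r A by (simp add: r0_def w_def field_simps)
    have f0: "f0 > 0" unfolding f0_def using A rpos assms(8) by simp
    have \<kappa>: "\<kappa> > 0" and \<beta>: "\<beta> > 0" using f0 w by (auto simp: \<kappa>_def \<beta>_def)
    have Ar: "A * r = r + w" by (simp add: w_def algebra_simps)
    have finV: "finite V"
      using assms(4) A rpos by (simp add: V_def finite_distance_balls_def)
    have \<rho>_lip: "\<bar>\<rho> x - \<rho> y\<bar> \<le> d x y" for x y
      using tri[of x0 x y] tri[of x0 y x] dsym[of x y] by (simp add: \<rho>_def)
    have q_lip: "\<bar>q x - q y\<bar> \<le> d x y" for x y
      using \<rho>_lip[of x y] unfolding q_def by linarith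
    have \<rho>_S: "\<bar>\<rho> x - \<rho> y\<bar> \<le> S" if "adj b x y" for x y
      using \<rho>_lip[of x y] dS[OF that] by linarith
    have nbr: "x \<in> V \<and> y \<in> V" if "\<eta> x \<noteq> 0" "adj b x y" for x y
    proof -
      have "\<rho> x < r + 7 * w / 8"
        using that(1) cutoff_eq_0[of "w / 4" "r + 7 * w / 8" "\<rho> x"] w by (force simp: \<eta>_def)
      then show ?thesis
        using \<rho>_S[OF that(2)] Sw w unfolding V_def dball_def Ar \<rho>_def by auto
    qed
    have \<theta>_diff: "\<bar>\<theta> x - \<theta> y\<bar> = \<kappa> * \<bar>q x - q y\<bar>" for x y
      using \<kappa> by (simp add: \<theta>_def abs_mult flip: right_diff_distrib)
    have \<theta>_lip: "\<bar>\<theta> x - \<theta> y\<bar> \<le> \<kappa> * d x y" for x y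
      using q_lip \<kappa> by (simp add: \<theta>_diff)
    have \<theta>_jump: "\<bar>\<theta> x - \<theta> y\<bar> \<le> K" if "adj b x y" for x y
    proof (cases "\<rho> x < r \<or> \<rho> y < r")
      case True
      then have "q x = q y" using \<rho>_S[OF that] S unfolding q_def by linarith
      then show ?thesis using C A by (simp add: \<theta>_diff K_def)
    next
      case False
      then have "d x y * f0 \<le> C * r"
        unfolding f0_def using \<open>r \<ge> r1\<close> rpos that
        by (intro local) (auto simp: \<rho>_def dsym[of _ x0])
      then have "\<kappa> * d x y \<le> 4 * (C * r) / w" using w by (simp add: \<kappa>_def field_simps)
      also have "\<dots> = K" using rpos by (simp add: K_def w_def)
      finally show ?thesis using \<theta>_lip[of x y] by linarith
    qed
    have \<eta>_lip: "\<bar>\<eta> x - \<eta> y\<bar> \<le> 4 / w * d x y" for x y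
    proof -
      have "\<bar>\<eta> x - \<eta> y\<bar> \<le> 1 / (w / 4) * \<bar>\<rho> x - \<rho> y\<bar>"
        unfolding \<eta>_def using w by (intro cutoff_lipschitz) simp
      also have "\<dots> \<le> 1 / (w / 4) * d x y" using w \<rho>_lip by (intro mult_left_mono) auto
      finally show ?thesis by simp
    qed
    have cut_small: "(fade (\<theta> y + \<beta> * s))\<^sup>2 \<le> exp (- 2 * f0)"
      if "adj b x y" "\<eta> x \<noteq> \<eta> y" "t - \<delta> \<le> s" for x y s
    proof -
      have "\<rho> y \<ge> r + 5 * w / 8 - S"
      proof (rule ccontr)
        assume "\<not> ?thesis"
        then have "\<rho> y \<le> r + 7 * w / 8 - w / 4" "\<rho> x \<le> r + 7 * w / 8 - w / 4"
          using \<rho>_S[OF that(1)] S by linarith+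
        then show False using that(2) w by (simp add: \<eta>_def cutoff_eq_1)
      qed
      then have "w / 4 \<le> q y - (r + w / 4)" using Sw unfolding q_def by linarith
      then have "\<kappa> * (w / 4) \<le> \<kappa> * (q y - (r + w / 4))" using \<kappa> by (intro mult_left_mono) auto
      moreover have "\<beta> * (t - \<delta>) \<le> \<beta> * s" using \<beta> that(3) by (intro mult_left_mono) auto
      moreover have "\<kappa> * (w / 4) = f0" using w by (simp add: \<kappa>_def)
      ultimately have "f0 \<le> \<theta> y + \<beta> * s" unfolding \<theta>_def by linarith
      then have "fade (\<theta> y + \<beta> * s) \<le> exp (- f0)"
        using fade_bounds(3)[of "\<theta> y + \<beta> * s"] by (smt (verit) exp_le_cancel_iff)
      then have "(fade (\<theta> y + \<beta> * s))\<^sup>2 \<le> (exp (- f0))\<^sup>2"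
        using fade_bounds(1)[of "\<theta> y + \<beta> * s"] by (intro power_mono) auto
      also have "\<dots> = exp (- 2 * f0)" by (simp flip: exp_double)
      finally show ?thesis .
    qed
    have growth: "\<Phi> t \<le> \<Psi> a + 2 * (4 / w)\<^sup>2 * exp (- 2 * f0) * exp f0" if a: "t - \<delta> < a" "a < t" for a
    proof -
      have sub: "{a..t} \<subseteq> time_interval T"
      proof
        fix s assume s: "s \<in> {a..t}"
        then have "ereal s \<le> ereal t" by simp
        then have "ereal s < T" using tT by (rule le_less_trans)
        then show "s \<in> time_interval T" using s a \<delta> by (simp add: time_interval_def)
      qed
      have "\<Phi> t \<le> \<Phi> a + 2 * (4 / w)\<^sup>2 * exp (- 2 * f0) * exp f0"
      proof (rule growth_le_nn_integral_rate[where \<Phi> = \<Phi> and a = a and t = t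
            and I = "time_interval T" and \<Psi> = \<Psi>])
        show "a \<le> t" using a by simp
        show "{a..t} \<subseteq> time_interval T" by (rule sub)
        show "\<exists>D. (\<Phi> has_real_derivative D) (at s) \<and> D \<le> 2 * (4 / w)\<^sup>2 * exp (- 2 * f0) * \<Psi> s"
          if s: "s \<in> {a..t}" for s
          unfolding \<Phi>_def \<Psi>_def
        proof (rule weighted_energy_derivative_le[OF assms(1,3,7) _ finV, where \<kappa> = \<kappa> and K = K])
          show "s \<in> time_interval T" using s sub by auto
          show "(fade (\<theta> y + \<beta> * s))\<^sup>2 \<le> exp (- 2 * f0)" if "adj b x y" "\<eta> x \<noteq> \<eta> y" for x y
            using that s a by (intro cut_small) auto
        qed (use nbr \<theta>_lip \<theta>_jump \<eta>_lip in \<open>auto simp: \<beta>_def\<close>)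
        have "continuous_on {a..t} (\<lambda>s. u s x)" for x
          using heat_solution_has_derivative[OF assms(7)] sub
          by (intro continuous_at_imp_continuous_on ballI) (blast intro: DERIV_isCont)
        then show "continuous_on {a..t} \<Psi>"
          unfolding \<Psi>_def by (intro continuous_intros)
        show "\<Psi> s \<ge> 0" for s
          unfolding \<Psi>_def using m by (intro sum_nonneg mult_nonneg_nonneg) (auto simp: less_imp_le)
        show "(\<integral>\<^sup>+s\<in>time_interval T. ennreal (\<Psi> s) \<partial>lborel) \<le> ennreal (exp f0)"
          using assms(10)[of "A * r"] A rpos by (simp add: \<Psi>_def V_def f0_def)
      qed auto
      also have "\<Phi> a \<le> \<Psi> a"
        unfolding \<Phi>_def \<Psi>_def
      proof (intro sum_mono mult_right_mono)
        fix x
        have "\<eta> x * fade (\<theta> x + \<beta> * a) \<le> 1" "0 \<le> \<eta> x * fade (\<theta> x + \<beta> * a)"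
          using cutoff_bounds fade_bounds(1,2)[of "\<theta> x + \<beta> * a"]
          by (auto simp: \<eta>_def intro!: mult_le_one)
        then have "(\<eta> x * fade (\<theta> x + \<beta> * a))\<^sup>2 \<le> 1" by (simp add: power_le_one)
        then show "(u a x)\<^sup>2 * (\<eta> x * fade (\<theta> x + \<beta> * a))\<^sup>2 \<le> (u a x)\<^sup>2"
          by (intro mult_left_le) auto
        show "0 \<le> m x" using m[of x] by simp
      qed
      finally show ?thesis by simp
    qed
    \<comment> \<open>Starting the flow at \<open>a > t - \<delta>\<close> and letting \<open>a\<close> decrease to \<open>t - \<delta>\<close> treats the initial
       time 0 and positive times alike, as both give convergence from the right.\<close>
    have limit: "(\<Psi> \<longlongrightarrow> (\<Sum>x\<in>V. (with_initial u0 u (t - \<delta>) x)\<^sup>2 * m x)) (at_right (t - \<delta>))"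
    proof -
      have "((\<lambda>s. u s x) \<longlongrightarrow> with_initial u0 u (t - \<delta>) x) (at_right (t - \<delta>))" for x
      proof (cases "t - \<delta> = 0")
        case True
        then show ?thesis using assms(7) by (simp add: heat_solution_def with_initial_def)
      next
        case False
        have "ereal (t - \<delta>) \<le> ereal t" using \<delta> by simp
        then have "ereal (t - \<delta>) < T" using tT by (rule le_less_trans)
        then have "t - \<delta> \<in> time_interval T" using False \<delta> by (simp add: time_interval_def)
        from DERIV_isCont[OF heat_solution_has_derivative[OF assms(7) this]]
        have "((\<lambda>s. u s x) \<longlongrightarrow> u (t - \<delta>) x) (at_right (t - \<delta>))"
          by (auto simp: isCont_def intro: filterlim_at_split[THEN iffD1, THEN conjunct2])
        then show ?thesis using False by (simp add: with_initial_def)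
      qed
      then show ?thesis unfolding \<Psi>_def by (intro tendsto_intros)
    qed
    have "\<Phi> t \<le> (\<Sum>x\<in>V. (with_initial u0 u (t - \<delta>) x)\<^sup>2 * m x)
        + 2 * (4 / w)\<^sup>2 * exp (- 2 * f0) * exp f0"
    proof (rule tendsto_lowerbound)
      show "((\<lambda>a. \<Psi> a + 2 * (4 / w)\<^sup>2 * exp (- 2 * f0) * exp f0)
        \<longlongrightarrow> (\<Sum>x\<in>V. (with_initial u0 u (t - \<delta>) x)\<^sup>2 * m x)
          + 2 * (4 / w)\<^sup>2 * exp (- 2 * f0) * exp f0) (at_right (t - \<delta>))"
        by (intro tendsto_intros limit)
      have "\<forall>\<^sub>F a in at_right (t - \<delta>). a \<in> {t - \<delta><..<t}"
        using \<delta> by (intro eventually_at_right_real) simp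
      then show "\<forall>\<^sub>F a in at_right (t - \<delta>). \<Phi> t \<le> \<Psi> a + 2 * (4 / w)\<^sup>2 * exp (- 2 * f0) * exp f0"
        by eventually_elim (use growth in auto)
    qed simp
    moreover have "4 * (2 * (4 / w)\<^sup>2 * exp (- 2 * f0) * exp f0) \<le> G * exp (- f0) / r\<^sup>2"
    proof -
      have "exp (- 2 * f0) * exp f0 = exp (- f0)" by (simp flip: exp_add)
      then have "4 * (2 * (4 / w)\<^sup>2 * exp (- 2 * f0) * exp f0) = 128 / (A - 1)\<^sup>2 * exp (- f0) / r\<^sup>2"
        by (simp add: w_def power_mult_distrib power_divide mult.assoc)
      also have "\<dots> \<le> G * exp (- f0) / r\<^sup>2"
        by (intro divide_right_mono mult_right_mono) (auto simp: G_def)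
      finally show ?thesis .
    qed
    moreover have "(\<Sum>x\<in>dball d x0 r. (u t x)\<^sup>2 * m x) \<le> 4 * \<Phi> t"
    proof -
      \<comment> \<open>the front travels at most \<open>w/8\<close>, hence stays outside radius \<open>r + w/8 \<ge> r + S\<close>\<close>
      have "\<beta> * \<delta> \<le> \<kappa> * (w / 8)"
      proof -
        have "\<delta> * (D * f0) \<le> r\<^sup>2" using \<delta>r D f0 by (simp add: f0_def pos_le_divide_eq)
        then have "32 * exp (4 * K) * (\<delta> * f0) \<le> D * (A - 1)\<^sup>2 * (\<delta> * f0)"
          using DA \<delta> f0 by (intro mult_right_mono) auto
        also have "\<dots> = (A - 1)\<^sup>2 * (\<delta> * (D * f0))" by simp
        also have "\<dots> \<le> (A - 1)\<^sup>2 * r\<^sup>2"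
          using \<open>\<delta> * (D * f0) \<le> r\<^sup>2\<close> by (intro mult_left_mono) auto
        also have "\<dots> = w\<^sup>2" by (simp add: w_def power_mult_distrib)
        finally have "exp (4 * K) * \<kappa> * \<delta> \<le> w / 8"
          using w by (simp add: \<kappa>_def field_simps power2_eq_square)
        from mult_left_mono[OF this less_imp_le[OF \<kappa>]] show ?thesis
          by (simp add: \<beta>_def power2_eq_square mult_ac)
      qed
      have ge: "1 / 4 \<le> (\<eta> x * fade (\<theta> x + \<beta> * t))\<^sup>2" if "x \<in> dball d x0 r" for x
      proof -
        have \<rho>: "\<rho> x \<le> r" using that by (simp add: dball_def \<rho>_def)
        then have "\<eta> x = 1" unfolding \<eta>_def using w by (intro cutoff_eq_1) auto
        have "\<kappa> * (q x - (r + w / 4)) \<le> \<kappa> * (- (w / 8))"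
          using \<rho> S Sw \<kappa> by (intro mult_left_mono) (auto simp: q_def)
        then have "\<theta> x + \<beta> * t \<le> 0"
          using \<open>\<beta> * \<delta> \<le> \<kappa> * (w / 8)\<close> by (simp add: \<theta>_def right_diff_distrib)
        from power_mono[OF fade_bounds(4)[OF this], of 2] show ?thesis
          using \<open>\<eta> x = 1\<close> by (simp add: power2_eq_square)
      qed
      have "(\<Sum>x\<in>dball d x0 r. (u t x)\<^sup>2 * m x)
          \<le> (\<Sum>x\<in>dball d x0 r. 4 * ((u t x)\<^sup>2 * (\<eta> x * fade (\<theta> x + \<beta> * t))\<^sup>2 * m x))"
      proof (rule sum_mono)
        fix x assume "x \<in> dball d x0 r"
        from mult_left_mono[OF ge[OF this], of "4 * ((u t x)\<^sup>2 * m x)"] m[of x]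
        show "(u t x)\<^sup>2 * m x \<le> 4 * ((u t x)\<^sup>2 * (\<eta> x * fade (\<theta> x + \<beta> * t))\<^sup>2 * m x)"
          by (simp add: mult_ac)
      qed
      also have "\<dots> \<le> (\<Sum>x\<in>V. 4 * ((u t x)\<^sup>2 * (\<eta> x * fade (\<theta> x + \<beta> * t))\<^sup>2 * m x))"
        using m w by (intro sum_mono2 finV) (auto simp: V_def dball_def Ar less_imp_le)
      finally show ?thesis by (simp add: \<Phi>_def sum_distrib_left)
    qed
    ultimately show ?thesis by (simp add: V_def f0_def)
  qed
  show ?thesis
    using r0 D A G main by (intro exI[of _ r0] exI[of _ D] exI[of _ A] exI[of _ 4] exI[of _ G]) auto
qed

end
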